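(* Let $(A,\mu,\{\cdot,\cdot,\cdot\},\alpha)$ be a non-commutative ternary Hom-Nambu-Poisson algebra (respectively, a ternary Hom-Nambu-Poisson algebra) and let $\beta:A\to A$ be a weak morphism. Then $$A_{\beta}=(A,\ \mu_{\beta}=\beta\circ\mu,\ \{\cdot,\cdot,\cdot\}_{\beta}=\beta\circ\{\cdot,\cdot,\cdot\},\ \beta\alpha)$$ is also a non-commutative ternary Hom-Nambu-Poisson algebra (respectively, a ternary Hom-Nambu-Poisson algebra). Moreover, if $A$ is multiplicative and $\beta$ is a morphism, then $A_{\beta}$ is multiplicative.
   Context: $\mathbb{K}$ is an algebraically closed field of characteristic zero; all vector spaces are over $\mathbb{K}$. A non-commutative ternary Hom-Nambu-Poisson algebra $(A,\mu,\{\cdot,\cdot,\cdot\},\alpha)$ consists of a vector space $A$, a bilinear map $\mu:A\times A\to A$, a trilinear map $\{\cdot,\cdot,\cdot\}:A\times A\times A\to A$ and a linear map $\alpha:A\to A$ such that, for all elements of $A$: (1) (Hom-associativity) $\mu(\alpha(x),\mu(y,z))=\mu(\mu(x,y),\alpha(z))$; (2) the bracket is skew-symmetric, $\{x_{\sigma(1)},x_{\sigma(2)},x_{\sigma(3)}\}=\mathrm{sgn}(\sigma)\{x_1,x_2,x_3\}$ for $\sigma\in S_3$, and satisfies the ternary Hom-Nambu identity $\{\alpha(x_1),\alpha(x_2),\{x_3,x_4,x_5\}\}=\{\{x_1,x_2,x_3\},\alpha(x_4),\alpha(x_5)\}+\{\alpha(x_3),\{x_1,x_2,x_4\},\alpha(x_5)\}+\{\alpha(x_3),\alpha(x_4),\{x_1,x_2,x_5\}\}$;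 (3) (Hom-Leibniz identity) $\{\mu(x_1,x_2),\alpha(x_3),\alpha(x_4)\}=\mu(\alpha(x_1),\{x_2,x_3,x_4\})+\mu(\{x_1,x_3,x_4\},\alpha(x_2))$. "Non-commutative" means that $\mu$ is not assumed commutative; when $\mu$ is commutative, it is called a ternary Hom-Nambu-Poisson algebra. It is multiplicative if $\alpha(\{x_1,x_2,x_3\})=\{\alpha(x_1),\alpha(x_2),\alpha(x_3)\}$ and $\alpha\circ\mu=\mu\circ\alpha^{\otimes 2}$. A weak morphism $f:(A,\mu,\{\cdot,\cdot,\cdot\},\alpha)\to(A',\mu',\{\cdot,\cdot,\cdot\}',\alpha')$ is a linear map with $f(\{x_1,x_2,x_3\})=\{f(x_1),f(x_2),f(x_3)\}'$ and $f\circ\mu=\mu'\circ f^{\otimes 2}$; it is a morphism if in addition $f\circ\alpha=\alpha'\circ f$. Here $\beta\alpha$ denotes the composition $\beta\circ\alpha$. *)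

theory Defs
  imports "HOL-Computational_Algebra.Polynomial" "HOL-Combinatorics.Permutations"
begin

text \<open>
  The vector space is the whole type \<open>'a\<close> with scalar multiplication \<open>scale\<close>; no restriction
  on its dimension is made.  The map \<open>\<mu>\<close> is not assumed commutative.
\<close>

locale nc_ternary_Hom_Nambu_Poisson = vector_space scale
  for scale :: "'k :: {alg_closed_field, field_char_0} \<Rightarrow> 'a :: ab_group_add \<Rightarrow> 'a" +
  fixes \<mu> :: "'a \<Rightarrow> 'a \<Rightarrow> 'a"
    and br :: "'a \<Rightarrow> 'a \<Rightarrow> 'a \<Rightarrow> 'a"
    and \<alpha> :: "'a \<Rightarrow> 'a"
  assumes twist_linear: "Vector_Spaces.linear scale scale \<alpha>"
    and mult_linear_1: "Vector_Spaces.linear scale scale (\<lambda>x. \<mu> x y)"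
    and mult_linear_2: "Vector_Spaces.linear scale scale (\<lambda>y. \<mu> x y)"
    and bracket_linear_1: "Vector_Spaces.linear scale scale (\<lambda>x. br x y z)"
    and bracket_linear_2: "Vector_Spaces.linear scale scale (\<lambda>y. br x y z)"
    and bracket_linear_3: "Vector_Spaces.linear scale scale (\<lambda>z. br x y z)"
    and Hom_assoc: "\<mu> (\<alpha> x) (\<mu> y z) = \<mu> (\<mu> x y) (\<alpha> z)"
    and bracket_skew: "\<sigma> permutes {1, 2, 3 :: nat} \<Longrightarrow>
      br (v (\<sigma> 1)) (v (\<sigma> 2)) (v (\<sigma> 3)) = scale (of_int (sign \<sigma>)) (br (v 1) (v 2) (v 3))"
    and Hom_Nambu:
      "br (\<alpha> x1) (\<alpha> x2) (br x3 x4 x5) =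
        br (br x1 x2 x3) (\<alpha> x4) (\<alpha> x5) + br (\<alpha> x3) (br x1 x2 x4) (\<alpha> x5)
          + br (\<alpha> x3) (\<alpha> x4) (br x1 x2 x5)"
    and Hom_Leibniz:
      "br (\<mu> x1 x2) (\<alpha> x3) (\<alpha> x4) = \<mu> (\<alpha> x1) (br x2 x3 x4) + \<mu> (br x1 x3 x4) (\<alpha> x2)"

locale ternary_Hom_Nambu_Poisson = nc_ternary_Hom_Nambu_Poisson +
  assumes mult_commute: "\<mu> x y = \<mu> y x"

locale multiplicative_nc_ternary_Hom_Nambu_Poisson = nc_ternary_Hom_Nambu_Poisson +
  assumes twist_bracket: "\<alpha> (br x y z) = br (\<alpha> x) (\<alpha> y) (\<alpha> z)"
    and twist_mult: "\<alpha> (\<mu> x y) = \<mu> (\<alpha> x) (\<alpha> y)"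

locale Hom_Nambu_Poisson_weak_morphism =
  A: nc_ternary_Hom_Nambu_Poisson scale \<mu> br \<alpha> +
  A': nc_ternary_Hom_Nambu_Poisson scale' \<mu>' br' \<alpha>' +
  Vector_Spaces.linear scale scale' f
  for scale :: "'k :: {alg_closed_field, field_char_0} \<Rightarrow> 'a :: ab_group_add \<Rightarrow> 'a"
    and \<mu> br \<alpha>
    and scale' :: "'k \<Rightarrow> 'b :: ab_group_add \<Rightarrow> 'b"
    and \<mu>' br' \<alpha>'
    and f :: "'a \<Rightarrow> 'b" +
  assumes map_bracket: "f (br x y z) = br' (f x) (f y) (f z)"
    and map_mult: "f (\<mu> x y) = \<mu>' (f x) (f y)"

locale Hom_Nambu_Poisson_morphism = Hom_Nambu_Poisson_weak_morphism +
  assumes map_twist: "f \<circ> \<alpha> = \<alpha>' \<circ> f"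

end

theory Submission
  imports Defs
begin

text \<open>A weak morphism commutes with both operations, so every application of
  \<open>\<beta>\<close> can be pulled to the outside. In Hom-associativity, the Hom-Nambu identity
  and the Hom-Leibniz identity for the twisted structure, each term contains two nested operations
  and becomes \<beta>^2 of the corresponding term of the original identity; by additivity the
  twisted identity is \<beta>^2 applied to the original one. Linearity, skew-symmetry and
  commutativity involve a single operation and survive one application of the linear map
  \<open>\<beta>\<close>. None of this requires \<open>\<beta>\<close> to commute with
  \<open>\<alpha>\<close>; multiplicativity does.\<close>

theorem theorem4p1:
  fixes scale :: "'k :: {alg_closed_field, field_char_0} \<Rightarrow> 'a :: ab_group_add \<Rightarrow> 'a"
    and \<mu> :: "'a \<Rightarrow> 'a \<Rightarrow> 'a"
    and br :: "'a \<Rightarrow> 'a \<Rightarrow> 'a \<Rightarrow> 'a"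
    and \<alpha> \<beta> :: "'a \<Rightarrow> 'a"
  assumes "nc_ternary_Hom_Nambu_Poisson scale \<mu> br \<alpha>"
    and "Hom_Nambu_Poisson_weak_morphism scale \<mu> br \<alpha> scale \<mu> br \<alpha> \<beta>"
  shows "nc_ternary_Hom_Nambu_Poisson scale
           (\<lambda>x y. \<beta> (\<mu> x y)) (\<lambda>x y z. \<beta> (br x y z)) (\<beta> \<circ> \<alpha>) \<and>
         (ternary_Hom_Nambu_Poisson scale \<mu> br \<alpha> \<longrightarrow>
          ternary_Hom_Nambu_Poisson scale
            (\<lambda>x y. \<beta> (\<mu> x y)) (\<lambda>x y z. \<beta> (br x y z)) (\<beta> \<circ> \<alpha>)) \<and>
         (multiplicative_nc_ternary_Hom_Nambu_Poisson scale \<mu> br \<alpha> \<longrightarrow>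
          Hom_Nambu_Poisson_morphism scale \<mu> br \<alpha> scale \<mu> br \<alpha> \<beta> \<longrightarrow>
          multiplicative_nc_ternary_Hom_Nambu_Poisson scale
            (\<lambda>x y. \<beta> (\<mu> x y)) (\<lambda>x y z. \<beta> (br x y z)) (\<beta> \<circ> \<alpha>))"
proof -
  interpret A: nc_ternary_Hom_Nambu_Poisson scale \<mu> br \<alpha> by fact
  interpret \<beta>: Hom_Nambu_Poisson_weak_morphism scale \<mu> br \<alpha> scale \<mu> br \<alpha> \<beta> by fact
  note comp = Vector_Spaces.linear_compose[OF _ \<beta>.linear_axioms, unfolded comp_def]
  have nc: "nc_ternary_Hom_Nambu_Poisson scale
      (\<lambda>x y. \<beta> (\<mu> x y)) (\<lambda>x y z. \<beta> (br x y z)) (\<beta> \<circ> \<alpha>)"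
  proof (intro nc_ternary_Hom_Nambu_Poisson.intro nc_ternary_Hom_Nambu_Poisson_axioms.intro
      A.vector_space_axioms)
    show "Vector_Spaces.linear scale scale (\<beta> \<circ> \<alpha>)"
      using A.twist_linear \<beta>.linear_axioms by (rule Vector_Spaces.linear_compose)
  next
    fix \<sigma> :: "nat \<Rightarrow> nat" and v :: "nat \<Rightarrow> 'a"
    assume "\<sigma> permutes {1, 2, 3}"
    then show "\<beta> (br (v (\<sigma> 1)) (v (\<sigma> 2)) (v (\<sigma> 3))) =
        scale (of_int (sign \<sigma>)) (\<beta> (br (v 1) (v 2) (v 3)))"
      by (simp only: A.bracket_skew \<beta>.scale)
  \<comment> \<open>The first alternative settles linearity in each argument. The second uses the
    morphism laws from right to left, which collects both copies of \<open>\<beta>\<close> in front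
    of each side; \<open>arg_cong\<close> then strips them and leaves an axiom of the original
    algebra.\<close>
  qed (rule comp, rule A.mult_linear_1 A.mult_linear_2 A.bracket_linear_1
      A.bracket_linear_2 A.bracket_linear_3
    | simp only: o_apply flip: \<beta>.map_mult \<beta>.map_bracket \<beta>.add,
      intro arg_cong[of _ _ \<beta>] A.Hom_assoc A.Hom_Nambu A.Hom_Leibniz)+
  moreover have "ternary_Hom_Nambu_Poisson scale
      (\<lambda>x y. \<beta> (\<mu> x y)) (\<lambda>x y z. \<beta> (br x y z)) (\<beta> \<circ> \<alpha>)"
    if "ternary_Hom_Nambu_Poisson scale \<mu> br \<alpha>"
  proof -
    interpret C: ternary_Hom_Nambu_Poisson scale \<mu> br \<alpha> by fact
    show ?thesis
      by (intro ternary_Hom_Nambu_Poisson.intro ternary_Hom_Nambu_Poisson_axioms.intro nc)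
        (simp only: C.mult_commute)
  qed
  moreover have "multiplicative_nc_ternary_Hom_Nambu_Poisson scale
      (\<lambda>x y. \<beta> (\<mu> x y)) (\<lambda>x y z. \<beta> (br x y z)) (\<beta> \<circ> \<alpha>)"
    if "multiplicative_nc_ternary_Hom_Nambu_Poisson scale \<mu> br \<alpha>"
      and "Hom_Nambu_Poisson_morphism scale \<mu> br \<alpha> scale \<mu> br \<alpha> \<beta>"
  proof -
    interpret M: multiplicative_nc_ternary_Hom_Nambu_Poisson scale \<mu> br \<alpha> by fact
    interpret F: Hom_Nambu_Poisson_morphism scale \<mu> br \<alpha> scale \<mu> br \<alpha> \<beta> by fact
    \<comment> \<open>This moves \<open>\<alpha>\<close> past the \<open>\<beta>\<close> built into
      the twisted operations. Pushing all maps inwards then turns both sides of each law into the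
      original operation with \<beta>^2 \<alpha> applied to every argument.\<close>
    have "\<alpha> (\<beta> x) = \<beta> (\<alpha> x)" for x
      using F.map_twist by (metis o_apply)
    then show ?thesis
      by (intro multiplicative_nc_ternary_Hom_Nambu_Poisson.intro
          multiplicative_nc_ternary_Hom_Nambu_Poisson_axioms.intro nc)
        (simp_all only: o_apply M.twist_bracket M.twist_mult \<beta>.map_bracket \<beta>.map_mult)
  qed
  ultimately show ?thesis by blast
qed

end
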